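(* Let $I \subset S=\Bbbk[x_1,\dots,x_n]$ be a symmetric shifted ideal. Then $I$ has linear quotients.
   Context: $\Bbbk$ is a field, $S=\Bbbk[x_1,\dots,x_n]$ with the standard grading, and the symmetric group $\mathfrak{S}_n$ acts on $S$ by $\sigma(x_i)=x_{\sigma(i)}$. A monomial ideal $I\subset S$ is $\mathfrak{S}_n$-fixed if $\sigma(I)=I$ for all $\sigma\in\mathfrak{S}_n$. Partitions of length $n$ are non-decreasing: $\mathrm{P}_n=\{(\lambda_1,\dots,\lambda_n)\in\mathbb{Z}^n: 0\le\lambda_1\le\cdots\le\lambda_n\}$. Write $x^\lambda=x_1^{\lambda_1}\cdots x_n^{\lambda_n}$. For an $\mathfrak{S}_n$-fixed monomial ideal $I$ put $\mathrm{P}(I)=\{\lambda\in\mathrm{P}_n: x^\lambda\in I\}$. An $\mathfrak{S}_n$-fixed monomial ideal $I$ is a symmetric shifted ideal if for every $\lambda\in\mathrm{P}(I)$ and every $1\le k<n$ with $\lambda_k<\lambda_n$ one has $x^\lambda(x_k/x_n)\in I$. For a monomial ideal $I$, $G(I)$ denotes its unique minimal set of monomial generators. $I$ has linear quotients if there is an ordering $u_1,\dots,u_s$ of the elements of $G(I)$ such that the colon ideal $(u_1,\dots,u_{k-1}):u_k$ is generated by a set of variables for all $k=2,\dots,s$. *)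

theory Defs
  imports Complex_Main "HOL-Library.Poly_Mapping"
begin

text \<open>
  The variables of \<open>S = k[x\<^sub>1,\<dots>,x\<^sub>n]\<close> are indexed by a finite linearly ordered type \<open>'n\<close>, which plays
  the role of \<open>{1 < \<dots> < n}\<close> with \<open>n = CARD('n)\<close>; the last index \<open>n\<close> is \<open>Max UNIV\<close>. Exponent vectors
  are finitely supported functions \<open>'n \<Rightarrow>\<^sub>0 nat\<close>, and multiplication of polynomials is the convolution
  product of \<open>Poly_Mapping\<close>.
\<close>

type_synonym ('n, 'k) mpoly = "('n \<Rightarrow>\<^sub>0 nat) \<Rightarrow>\<^sub>0 'k"

definition monom :: "('n \<Rightarrow>\<^sub>0 nat) \<Rightarrow> ('n, 'k::field) mpoly" where
  "monom m = Poly_Mapping.single m 1"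

definition Var :: "'n \<Rightarrow> ('n, 'k::field) mpoly" where
  "Var i = monom (Poly_Mapping.single i 1)"

definition Const :: "'k \<Rightarrow> ('n, 'k::field) mpoly" where
  "Const c = Poly_Mapping.single 0 c"


text \<open>Ideals are the submodules of a commutative ring regarded as a module over itself.\<close>

lemma module_times: "module ((*) :: 'a::comm_ring_1 \<Rightarrow> 'a \<Rightarrow> 'a)"
  by (rule module.intro) (simp_all add: algebra_simps)

abbreviation is_ideal :: "'a::comm_ring_1 set \<Rightarrow> bool" where
  "is_ideal \<equiv> module.subspace (*)"

abbreviation ideal_gen :: "'a::comm_ring_1 set \<Rightarrow> 'a set" where
  "ideal_gen \<equiv> module.span (*)"

definition colon :: "'a::comm_ring_1 set \<Rightarrow> 'a \<Rightarrow> 'a set" where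
  "colon J u = {f. f * u \<in> J}"

definition is_monomial_ideal :: "('n, 'k::field) mpoly set \<Rightarrow> bool" where
  "is_monomial_ideal I \<longleftrightarrow> is_ideal I \<and> (\<exists>M. I = ideal_gen (monom ` M))"


text \<open>The \<open>k\<close>-algebra endomorphism of \<open>S\<close> with \<open>x\<^sub>i \<mapsto> x\<^bsub>\<sigma>(i)\<^esub>\<close>.\<close>

definition act :: "('n \<Rightarrow> 'n) \<Rightarrow> ('n::finite, 'k::field) mpoly \<Rightarrow> ('n, 'k) mpoly" where
  "act \<sigma> p = (\<Sum>m\<in>Poly_Mapping.keys p.
     Const (Poly_Mapping.lookup p m) * (\<Prod>i\<in>UNIV. Var (\<sigma> i) ^ Poly_Mapping.lookup m i))"

definition sym_fixed :: "('n::finite, 'k::field) mpoly set \<Rightarrow> bool" where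
  "sym_fixed I \<longleftrightarrow> (\<forall>\<sigma>. bij \<sigma> \<longrightarrow> act \<sigma> ` I = I)"

definition partitions :: "('n::{finite,linorder} \<Rightarrow>\<^sub>0 nat) set" where
  "partitions = {\<mu>. mono (Poly_Mapping.lookup \<mu>)}"

definition partitions_of :: "('n::{finite,linorder}, 'k::field) mpoly set \<Rightarrow> ('n \<Rightarrow>\<^sub>0 nat) set" where
  "partitions_of I = {\<mu> \<in> partitions. monom \<mu> \<in> I}"

abbreviation last_index :: "'n::{finite,linorder}" where
  "last_index \<equiv> Max UNIV"

text \<open>
  Below, \<open>x\<^sup>\<mu> (x\<^sub>k / x\<^sub>n)\<close> has exponent vector \<open>\<mu> + e\<^sub>k - e\<^sub>n\<close>. The subtraction is not truncated since
  \<open>\<mu>\<^sub>k < \<mu>\<^sub>n\<close> forces \<open>\<mu>\<^sub>n > 0\<close>.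
\<close>

definition symmetric_shifted_ideal :: "('n::{finite,linorder}, 'k::field) mpoly set \<Rightarrow> bool" where
  "symmetric_shifted_ideal I \<longleftrightarrow>
     is_monomial_ideal I \<and> sym_fixed I \<and>
     (\<forall>\<mu>\<in>partitions_of I. \<forall>k<last_index.
        Poly_Mapping.lookup \<mu> k < Poly_Mapping.lookup \<mu> last_index \<longrightarrow>
        monom (\<mu> + Poly_Mapping.single k 1 - Poly_Mapping.single last_index 1) \<in> I)"


definition is_min_monomial_gens ::
    "('n, 'k::field) mpoly set \<Rightarrow> ('n, 'k) mpoly set \<Rightarrow> bool" where
  "is_min_monomial_gens G I \<longleftrightarrow>
     G \<subseteq> range monom \<and> ideal_gen G = I \<and> (\<forall>H. H \<subset> G \<longrightarrow> ideal_gen H \<noteq> I)"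

text \<open>\<open>G(I)\<close>; only meaningful for monomial ideals, where the minimal set exists and is unique.\<close>

definition min_gens :: "('n, 'k::field) mpoly set \<Rightarrow> ('n, 'k) mpoly set" where
  "min_gens I = (THE G. is_min_monomial_gens G I)"

text \<open>The list \<open>us\<close> is the ordering \<open>u\<^sub>1,\<dots>,u\<^sub>s\<close>, with indices shifted down by one.\<close>

definition linear_quotients :: "('n, 'k::field) mpoly set \<Rightarrow> bool" where
  "linear_quotients I \<longleftrightarrow>
     (\<exists>us. distinct us \<and> set us = min_gens I \<and>
       (\<forall>k. 1 \<le> k \<and> k < length us \<longrightarrow>
          (\<exists>V. colon (ideal_gen (set (take k us))) (us ! k) = ideal_gen (Var ` V))))"

end

theory Submission
  imports Defs "HOL-Library.Product_Lexorder"
begin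

text \<open>
  Membership of a monomial in a monomial ideal is divisibility by a generator, so everything can be
  said about the set \<open>A\<close> of exponent vectors of the monomials in \<open>I\<close>. The minimal generators are the
  divisibility-minimal elements of \<open>A\<close>, finite in number by Dickson's lemma. Sorting an exponent
  vector by a permutation turns the shifting condition, which speaks of partitions only, into a
  condition on all of \<open>A\<close>: if \<open>a\<^sub>k < a\<^sub>m\<close> and \<open>a\<^sub>m\<close> is the largest entry of \<open>a \<in> A\<close>, then
  \<open>a + e\<^sub>k - e\<^sub>m \<in> A\<close> (\<open>move_closed_exps\<close>).

  Order the generators by degree, then by the largest entry, then by the number of entries where it
  is attained, and finally lexicographically. Linear quotients follow from an exchange property
  (\<open>minimal_exps_exchange\<close>): if the generator \<open>b\<close> precedes the generator \<open>a\<close>, then some generator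
  \<open>c\<close> that precedes \<open>a\<close> divides \<open>a + e\<^sub>k\<close> for an index \<open>k\<close> with \<open>a\<^sub>k < b\<^sub>k\<close>. Indeed the variable \<open>x\<^sub>k\<close>
  then lies in the colon ideal, and it divides the quotient of \<open>x\<^sup>b\<close> by its greatest common divisor
  with \<open>x\<^sup>a\<close>.

  For the exchange property, let \<open>M\<close> be the largest entry of \<open>a\<close>. Moving a unit from an entry \<open>M\<close> at \<open>m\<close>
  to an entry \<open>a\<^sub>k < b\<^sub>k\<close> stays in \<open>A\<close>, and gives an earlier exponent vector if \<open>a\<^sub>k \<le> M - 2\<close>, or if
  \<open>a\<^sub>k = M - 1\<close> and \<open>m < k\<close>. If no such move exists, then \<open>b\<close> exceeds \<open>a\<close> only where \<open>a\<close> is at least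
  \<open>M - 1\<close>. For \<open>b\<close> of the same degree, a count of the entries equal to \<open>M\<close> shows that \<open>b\<close> would come
  after \<open>a\<close> lexicographically (\<open>same_degree_exchange\<close>). For \<open>b\<close> of smaller degree, units are moved
  inside \<open>b\<close>, away from its largest entry, until \<open>b\<close> exceeds \<open>a\<close> by a single unit
  (\<open>excess_reduction\<close>).
\<close>

section \<open>Exponent vectors\<close>

abbreviation expo :: "('n \<Rightarrow>\<^sub>0 nat) \<Rightarrow> 'n \<Rightarrow> nat" where
  "expo \<equiv> Poly_Mapping.lookup"

abbreviation unit_exp :: "'n \<Rightarrow> ('n \<Rightarrow>\<^sub>0 nat)" where
  "unit_exp i \<equiv> Poly_Mapping.single i 1"

text \<open>
  Divisibility of monomials is the pointwise order. It needs a symbol of its own because \<open>\<le>\<close> on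
  finitely supported functions is the lexicographic order.
\<close>

definition exp_dvd :: "('n \<Rightarrow>\<^sub>0 nat) \<Rightarrow> ('n \<Rightarrow>\<^sub>0 nat) \<Rightarrow> bool" (infix "\<unlhd>" 50) where
  "a \<unlhd> b \<longleftrightarrow> (\<forall>i. expo a i \<le> expo b i)"

lemma exp_dvd_refl [simp]: "a \<unlhd> a"
  by (simp add: exp_dvd_def)

lemma exp_dvd_trans [trans]: "a \<unlhd> b \<Longrightarrow> b \<unlhd> c \<Longrightarrow> a \<unlhd> c"
  unfolding exp_dvd_def using le_trans by blast

lemma exp_dvd_add: "a \<unlhd> a + b"
  by (simp add: exp_dvd_def lookup_add)

lemma exp_dvd_diff_add: "a \<unlhd> b \<Longrightarrow> a + (b - a) = b"
  by (intro poly_mapping_eqI) (simp add: exp_dvd_def lookup_add lookup_minus)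

definition total_degree :: "('n::finite \<Rightarrow>\<^sub>0 nat) \<Rightarrow> nat" where
  "total_degree a = (\<Sum>i\<in>UNIV. expo a i)"

lemma total_degree_add: "total_degree (a + b) = total_degree a + total_degree b"
  by (simp add: total_degree_def lookup_add sum.distrib)

lemma total_degree_unit_exp [simp]: "total_degree (unit_exp i) = 1"
  by (simp add: total_degree_def lookup_single when_def)

lemma exp_dvd_imp_less_degree:
  assumes "a \<unlhd> b" "a \<noteq> b"
  shows "total_degree a < total_degree b"
proof -
  obtain i where "expo a i \<noteq> expo b i"
    using assms(2) by (auto simp: poly_mapping_eq_iff fun_eq_iff)
  then have "expo a i < expo b i"
    using assms(1) by (auto simp: exp_dvd_def order_less_le)
  then show ?thesis
    unfolding total_degree_def using assms(1)
    by (intro sum_strict_mono_ex1) (auto simp: exp_dvd_def)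
qed

definition minimal_exps :: "('n \<Rightarrow>\<^sub>0 nat) set \<Rightarrow> ('n \<Rightarrow>\<^sub>0 nat) set" where
  "minimal_exps A = {a \<in> A. \<forall>c\<in>A. c \<unlhd> a \<longrightarrow> c = a}"

lemma ex_minimal_exp_below:
  fixes a :: "'n::finite \<Rightarrow>\<^sub>0 nat"
  assumes "a \<in> A"
  shows "\<exists>c\<in>minimal_exps A. c \<unlhd> a"
  using assms
proof (induction "total_degree a" arbitrary: a rule: less_induct)
  case less
  show ?case
  proof (cases "a \<in> minimal_exps A")
    case False
    then obtain c where "c \<in> A" "c \<unlhd> a" "c \<noteq> a"
      using less.prems by (auto simp: minimal_exps_def)
    then show ?thesis
      using less.hyps[of c] exp_dvd_imp_less_degree exp_dvd_trans by blast
  qed (use exp_dvd_refl in blast)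
qed

section \<open>Dickson's lemma\<close>

text \<open>
  A monotone subsequence exists in any linear order; a decreasing one of natural numbers is constant
  from the point on where its least value is taken.
\<close>

lemma nat_seq_incseq_subseq:
  fixes s :: "nat \<Rightarrow> nat"
  shows "\<exists>r::nat \<Rightarrow> nat. strict_mono r \<and> incseq (s \<circ> r)"
proof -
  obtain r :: "nat \<Rightarrow> nat" where r: "strict_mono r" "monoseq (\<lambda>n. s (r n))"
    using seq_monosub by blast
  show ?thesis
  proof (cases "incseq (s \<circ> r)")
    case False
    then have dec: "decseq (\<lambda>n. s (r n))"
      using r(2) by (auto simp: monoseq_iff comp_def)
    define n0 where "n0 = (ARG_MIN (\<lambda>n. s (r n)) n. True)"
    have "s (r n0) \<le> s (r n)" for n
      unfolding n0_def by (rule arg_min_nat_le) simp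
    then have "s (r (n0 + n)) = s (r n0)" for n
      using decseqD[OF dec, of n0 "n0 + n"] by (simp add: order_antisym)
    then have "incseq (s \<circ> (\<lambda>n. r (n0 + n)))"
      by (simp add: incseq_def)
    moreover have "strict_mono (\<lambda>n. r (n0 + n))"
      using r(1) by (simp add: strict_mono_def)
    ultimately show ?thesis by blast
  qed (use r in blast)
qed

lemma exp_seq_incseq_subseq:
  fixes s :: "nat \<Rightarrow> ('n \<Rightarrow>\<^sub>0 nat)"
  assumes "finite F"
  shows "\<exists>r::nat \<Rightarrow> nat. strict_mono r \<and> (\<forall>i\<in>F. incseq (\<lambda>n. expo (s (r n)) i))"
  using assms
proof (induction F)
  case empty
  show ?case using strict_mono_id by blast
next
  case (insert i F)
  then obtain r :: "nat \<Rightarrow> nat" where r: "strict_mono r"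
    "\<forall>j\<in>F. incseq (\<lambda>n. expo (s (r n)) j)" by blast
  obtain q :: "nat \<Rightarrow> nat" where q: "strict_mono q" "incseq ((\<lambda>n. expo (s (r n)) i) \<circ> q)"
    using nat_seq_incseq_subseq by blast
  have "incseq (\<lambda>n. expo (s (r (q n))) j)" if "j \<in> F" for j
    using r(2) that q(1) by (simp add: incseq_def strict_mono_less_eq)
  then show ?case
    using r(1) q strict_mono_o[OF r(1) q(1)] by (intro exI[of _ "r \<circ> q"]) (auto simp: comp_def)
qed

text \<open>
  Infinitely many minimal exponents would contain a subsequence increasing in every coordinate, hence
  two distinct ones of which the first divides the second.
\<close>

lemma finite_minimal_exps:
  fixes A :: "('n::finite \<Rightarrow>\<^sub>0 nat) set"
  shows "finite (minimal_exps A)"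
proof (rule ccontr)
  assume "infinite (minimal_exps A)"
  then obtain s :: "nat \<Rightarrow> ('n \<Rightarrow>\<^sub>0 nat)" where s: "inj s" "range s \<subseteq> minimal_exps A"
    using infinite_countable_subset by blast
  obtain r :: "nat \<Rightarrow> nat" where r: "strict_mono r" "\<forall>i. incseq (\<lambda>n. expo (s (r n)) i)"
    using exp_seq_incseq_subseq[of UNIV s] by auto
  have "s (r 0) \<unlhd> s (r 1)"
    using r(2) by (simp add: exp_dvd_def incseq_def)
  then have "s (r 0) = s (r 1)"
    using s(2) unfolding minimal_exps_def by blast
  then show False
    using s(1) r(1) by (metis injD strict_mono_eq zero_neq_one)
qed

section \<open>The exchange property\<close>

text \<open>
  The exponent vector of \<open>x\<^sup>a (x\<^sub>k / x\<^sub>m)\<close>. For \<open>k \<noteq> m\<close> it has this meaning only if \<open>a\<^sub>m > 0\<close>, since the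
  subtraction is truncated.
\<close>

definition move :: "'n \<Rightarrow> 'n \<Rightarrow> ('n \<Rightarrow>\<^sub>0 nat) \<Rightarrow> ('n \<Rightarrow>\<^sub>0 nat)" where
  "move k m a = a + unit_exp k - unit_exp m"

lemma expo_move:
  assumes "0 < expo a m" "k \<noteq> m"
  shows "expo (move k m a) i =
    (if i = k then expo a k + 1 else if i = m then expo a m - 1 else expo a i)"
  using assms by (auto simp: move_def lookup_add lookup_minus lookup_single when_def)

lemma total_degree_move:
  assumes "0 < expo a m"
  shows "total_degree (move k m a) = total_degree a"
proof -
  have "move k m a + unit_exp m = a + unit_exp k"
    using assms
    by (intro poly_mapping_eqI) (auto simp: move_def lookup_add lookup_minus lookup_single when_def)
  then show ?thesis
    by (metis add_right_cancel total_degree_add total_degree_unit_exp)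
qed

lemma move_dvd: "move k m a \<unlhd> a + unit_exp k"
  by (simp add: exp_dvd_def move_def lookup_minus)

definition height :: "('n::finite \<Rightarrow>\<^sub>0 nat) \<Rightarrow> nat" where
  "height a = Max (range (expo a))"

definition peaks :: "('n::finite \<Rightarrow>\<^sub>0 nat) \<Rightarrow> 'n set" where
  "peaks a = {i. expo a i = height a}"

lemma expo_le_height: "expo a i \<le> height a"
  by (simp add: height_def)

lemma height_attained: "\<exists>m. expo a m = height a"
  unfolding height_def using Max_in[of "range (expo a)"] by fastforce

lemma height_eqI: "expo a m = h \<Longrightarrow> (\<And>i. expo a i \<le> h) \<Longrightarrow> height a = h"
  unfolding height_def by (intro Max_eqI) auto

definition move_closed :: "('n \<Rightarrow>\<^sub>0 nat) set \<Rightarrow> bool" where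
  "move_closed A \<longleftrightarrow> (\<forall>a\<in>A. \<forall>k m. expo a k < expo a m \<longrightarrow> (\<forall>i. expo a i \<le> expo a m) \<longrightarrow> move k m a \<in> A)"

text \<open>
  The key by which the generators are ordered; products carry the lexicographic order.
  The key has to make two kinds of moves go down: flattening a largest entry, which is what the second
  and third components are for, and exchanging a largest entry \<open>M\<close> with a later entry \<open>M - 1\<close>, for which
  the lexicographic order of the vectors themselves decides.
\<close>

definition gen_key :: "('n::{finite,linorder} \<Rightarrow>\<^sub>0 nat) \<Rightarrow> nat \<times> nat \<times> nat \<times> ('n \<Rightarrow>\<^sub>0 nat)" where
  "gen_key a = (total_degree a, height a, card (peaks a), a)"

lemma gen_key_inject [simp]: "gen_key a = gen_key b \<longleftrightarrow> a = b"
  by (auto simp: gen_key_def)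

lemma gen_key_less_if_degree_less:
  "total_degree a < total_degree b \<Longrightarrow> gen_key a < gen_key b"
  by (simp add: gen_key_def)

lemma exp_dvd_imp_gen_key_le: "a \<unlhd> b \<Longrightarrow> gen_key a \<le> gen_key b"
  using exp_dvd_imp_less_degree gen_key_less_if_degree_less by (metis order.strict_implies_order order_refl)

lemma exp_less_iff:
  "a < b \<longleftrightarrow> (\<exists>k. expo a k < expo b k \<and> (\<forall>j<k. expo a j = expo b j))"
  by transfer (simp add: less_fun_def)

lemma gen_key_move_flatter:
  assumes m: "expo a m = height a" and k: "expo a k + 2 \<le> expo a m"
  shows "gen_key (move k m a) < gen_key a"
proof -
  have ne: "k \<noteq> m" and pos: "0 < expo a m" using k by auto
  let ?c = "move k m a"
  have le: "expo ?c i \<le> height a" for i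
    using expo_le_height[of a i] expo_le_height[of a m] k m by (auto simp: expo_move[OF pos ne])
  show ?thesis
  proof (cases "height ?c = height a")
    case True
    have "i \<in> peaks a \<and> i \<noteq> m" if "i \<in> peaks ?c" for i
      using that k m unfolding peaks_def True mem_Collect_eq expo_move[OF pos ne]
      by (simp split: if_splits)
    moreover have "m \<in> peaks a" using m by (simp add: peaks_def)
    ultimately have "peaks ?c \<subset> peaks a" by blast
    then have "card (peaks ?c) < card (peaks a)"
      by (simp add: psubset_card_mono)
    then show ?thesis
      using total_degree_move[OF pos] True by (simp add: gen_key_def)
  next
    case False
    then have "height ?c < height a"
      using height_attained[of ?c] le by (metis order_less_le)
    then show ?thesis
      using total_degree_move[OF pos] by (simp add: gen_key_def)
  qed
qed

lemma gen_key_move_swap: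
  assumes m: "expo a m = height a" and k: "expo a k + 1 = expo a m" and "m < k"
  shows "gen_key (move k m a) < gen_key a"
proof -
  have ne: "k \<noteq> m" and pos: "0 < expo a m" using k by auto
  let ?c = "move k m a"
  have height: "height ?c = height a"
  proof (rule height_eqI)
    show "expo ?c k = height a" using k m by (simp add: expo_move[OF pos ne])
    show "expo ?c i \<le> height a" for i
      using expo_le_height[of a i] k m by (auto simp: expo_move[OF pos ne])
  qed
  have "peaks ?c = insert k (peaks a - {m})"
    unfolding peaks_def height using k m ne by (auto simp: expo_move[OF pos ne] split: if_splits)
  moreover have "m \<in> peaks a" "k \<notin> peaks a" using m k by (auto simp: peaks_def)
  ultimately have "card (peaks ?c) = card (peaks a)"
    using card.remove[of "peaks a" m] by simp
  moreover have "?c < a"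
    unfolding exp_less_iff using pos ne \<open>m < k\<close>
    by (intro exI[of _ m]) (auto simp: expo_move[OF pos ne])
  ultimately show ?thesis
    using total_degree_move[OF pos] height by (simp add: gen_key_def)
qed

text \<open>
  As long as \<open>b\<close> exceeds \<open>a\<close> by more than one unit, one of the largest entries of \<open>b\<close> exceeds the
  entry of \<open>a\<close>: the entries of \<open>b\<close> that exceed \<open>a\<close> are at least the largest entry of \<open>a\<close>. As \<open>b\<close> has
  the smaller degree, it also has an entry below that of \<open>a\<close>, and moving a unit there keeps \<open>b\<close> in \<open>A\<close>
  and lowers the total excess. The excess never vanishes, because elements of \<open>A\<close> of smaller degree do
  not divide \<open>a\<close>.
\<close>

lemma excess_reduction:
  fixes a b :: "'n::finite \<Rightarrow>\<^sub>0 nat"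
  assumes A: "move_closed A"
    and a: "\<And>c. c \<in> A \<Longrightarrow> total_degree c < total_degree a \<Longrightarrow> \<not> c \<unlhd> a"
    and "b \<in> A" "total_degree b < total_degree a"
    and "\<And>k i. expo a k < expo b k \<Longrightarrow> expo a i \<le> expo a k + 1"
  shows "\<exists>c\<in>A. \<exists>k. total_degree c < total_degree a \<and> expo a k < expo b k \<and> c \<unlhd> a + unit_exp k"
  using assms(3-5)
proof (induction "\<Sum>i\<in>UNIV. expo b i - expo a i" arbitrary: b rule: less_induct)
  case less
  note top = less.prems(3)
  obtain k0 where k0: "expo a k0 < expo b k0"
    using a less.prems(1,2) by (meson exp_dvd_def not_le)
  \<comment> \<open>an index at which \<open>b\<close> is largest and exceeds \<open>a\<close>: either \<open>m1\<close> or \<open>k0\<close>\<close>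
  obtain m1 where m1: "expo b m1 = height b" using height_attained by blast
  obtain m where m: "expo a m < expo b m" "\<And>i. expo b i \<le> expo b m"
  proof (cases "expo a m1 < expo b m1")
    case True
    then show ?thesis using that m1 expo_le_height by metis
  next
    case False
    then have "expo b m1 \<le> expo b k0" using top[OF k0, of m1] k0 by linarith
    then show ?thesis using that k0 m1 expo_le_height by (metis order.trans)
  qed
  have "\<exists>j. expo b j < expo a j"
    using less.prems(2) unfolding total_degree_def by (meson linorder_not_le sum_mono)
  then obtain j where j: "expo b j < expo a j" by blast
  show ?case
  proof (cases "b \<unlhd> a + unit_exp m")
    case True
    then show ?thesis using less.prems m by blast
  next
    case False
    have pos: "0 < expo b m" and ne: "j \<noteq> m" using m j by auto
    let ?b = "move j m b"
    note move = expo_move[OF pos ne]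
    have "expo b j < expo b m" using j top[OF m(1), of j] m(1) by linarith
    then have "?b \<in> A"
      using A less.prems(1) m(2) by (simp add: move_closed_def)
    moreover have deg: "total_degree ?b < total_degree a"
      using total_degree_move[OF pos] less.prems(2) by simp
    moreover have ex: "expo a k < expo b k" if "expo a k < expo ?b k" for k
      using that j by (auto simp: move split: if_splits)
    moreover have "(\<Sum>i\<in>UNIV. expo ?b i - expo a i) < (\<Sum>i\<in>UNIV. expo b i - expo a i)"
    proof (rule sum_strict_mono_ex1)
      show "\<forall>i\<in>UNIV. expo ?b i - expo a i \<le> expo b i - expo a i"
        using j by (auto simp: move)
      show "\<exists>i\<in>UNIV. expo ?b i - expo a i < expo b i - expo a i"
        using m(1) ne by (intro bexI[of _ m]) (auto simp: move)
    qed simp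
    ultimately show ?thesis
      using less.hyps[of ?b] top by meson
  qed
qed

text \<open>
  Let \<open>M\<close> be the largest entry of \<open>a\<close>. If the conclusion fails, then at each \<open>k\<close> with \<open>a\<^sub>k < b\<^sub>k\<close> the
  entries are \<open>M - 1\<close> and \<open>M\<close>, so the total gain of \<open>b\<close> over \<open>a\<close> is the number of these \<open>k\<close>. The
  total loss is the same, so at most that many entries decrease. But \<open>b\<close> must not have more entries
  \<open>M\<close> than \<open>a\<close>, so at least that many entries \<open>M\<close> of \<open>a\<close> decrease. Hence only entries \<open>M\<close> decrease,
  and both vectors have equally many of them. Now \<open>b\<close> precedes \<open>a\<close> lexicographically, so a
  decreasing entry \<open>M\<close> comes before all increasing entries \<open>M - 1\<close>: these two can be exchanged after all.
\<close>

lemma same_degree_exchange: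
  fixes a b :: "'n::{finite,linorder} \<Rightarrow>\<^sub>0 nat"
  assumes deg: "total_degree b = total_degree a" and less: "gen_key b < gen_key a"
  shows "\<exists>k m. expo a k < expo b k \<and> expo a m = height a \<and>
    (expo a k + 2 \<le> expo a m \<or> expo a k + 1 = expo a m \<and> m < k)"
proof (rule ccontr)
  assume no_move: "\<not> ?thesis"
  define K where "K = {k. expo a k < expo b k}"
  define D where "D = {i. expo b i < expo a i}"
  have "b \<noteq> a" using less by auto
  have hb: "height b \<le> height a" using less deg by (auto simp: gen_key_def)
  have b_le: "expo b i \<le> height a" for i
    using expo_le_height[of b i] hb by simp
  obtain m0 where m0: "expo a m0 = height a" using height_attained by blast
  have K: "expo a k + 1 = height a \<and> expo b k = height a" if "k \<in> K" for k
  proof -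
    have "\<not> expo a k + 2 \<le> expo a m0" using no_move that m0 unfolding K_def by blast
    then show ?thesis using b_le[of k] that m0 unfolding K_def by auto
  qed
  have sums: "(\<Sum>i\<in>UNIV. expo b i - expo a i) = (\<Sum>i\<in>UNIV. expo a i - expo b i)"
  proof -
    have "(\<Sum>i\<in>UNIV. expo a i) + (\<Sum>i\<in>UNIV. expo b i - expo a i) =
        (\<Sum>i\<in>UNIV. expo b i) + (\<Sum>i\<in>UNIV. expo a i - expo b i)"
      unfolding sum.distrib[symmetric] by (rule sum.cong) auto
    then show ?thesis using deg by (simp add: total_degree_def)
  qed
  have "(\<Sum>i\<in>UNIV. expo b i - expo a i) = (\<Sum>i\<in>UNIV. if i \<in> K then 1 else 0)"
  proof (rule sum.cong)
    show "expo b i - expo a i = (if i \<in> K then 1 else 0)" for i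
      using K[of i] by (cases "i \<in> K") (auto simp: K_def)
  qed simp
  then have card_K: "(\<Sum>i\<in>UNIV. expo b i - expo a i) = card K"
    by (simp add: sum.If_cases)
  have "(\<Sum>i\<in>UNIV. if i \<in> D then 1 else 0) \<le> (\<Sum>i\<in>UNIV. expo a i - expo b i)"
    by (rule sum_mono) (auto simp: D_def)
  then have card_D: "card D \<le> card K"
    using sums card_K by (simp add: sum.If_cases)
  have "K \<noteq> {}"
  proof
    assume "K = {}"
    then have "b \<unlhd> a" unfolding K_def exp_dvd_def by (auto simp: not_less)
    then show False using exp_dvd_imp_less_degree \<open>b \<noteq> a\<close> deg by fastforce
  qed
  then obtain k where k: "k \<in> K" by blast
  have heights: "height b = height a"
    by (rule height_eqI[of b k]) (use K[OF k] b_le in auto)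
  have "peaks b = K \<union> (peaks a - D)"
    unfolding peaks_def heights
  proof (intro set_eqI iffI)
    fix i assume "i \<in> {i. expo b i = height a}"
    then show "i \<in> K \<union> ({i. expo a i = height a} - D)"
      using expo_le_height[of a i] by (auto simp: K_def D_def)
  next
    fix i assume "i \<in> K \<union> ({i. expo a i = height a} - D)"
    then show "i \<in> {i. expo b i = height a}"
      using K[of i] b_le[of i] by (auto simp: D_def)
  qed
  moreover have "K \<inter> (peaks a - D) = {}"
    using K by (force simp: peaks_def)
  ultimately have peaks_b: "card (peaks b) = card K + card (peaks a - D)"
    by (simp add: card_Un_disjoint)
  have peaks_a: "card (peaks a) = card (peaks a \<inter> D) + card (peaks a - D)"
    by (metis card_Int_Diff finite)
  have "card (peaks b) \<le> card (peaks a)"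
    using less deg heights by (auto simp: gen_key_def)
  then have "card D \<le> card (peaks a \<inter> D)"
    using peaks_b peaks_a card_D by linarith
  then have D_peaks: "D \<subseteq> peaks a"
    by (metis card_seteq finite inf.cobounded2 inf.orderI inf_commute)
  then have "card (peaks b) \<ge> card (peaks a)"
    using peaks_b peaks_a card_D by (metis add_le_mono1 inf.absorb2)
  then have "b < a"
    using less deg heights \<open>card (peaks b) \<le> card (peaks a)\<close> by (simp add: gen_key_def)
  then obtain i where i: "expo b i < expo a i" "\<forall>j<i. expo b j = expo a j"
    unfolding exp_less_iff by blast
  have "expo a i = height a" using D_peaks i(1) unfolding D_def peaks_def by blast
  moreover have "expo a k < expo b k" "expo a k + 1 = height a"
    using k K[OF k] by (simp_all add: K_def)
  ultimately have "\<not> i < k" using no_move by metis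
  moreover have "\<not> k < i" using i(2) k unfolding K_def by fastforce
  moreover have "i \<noteq> k" using i(1) k unfolding K_def by fastforce
  ultimately show False by (meson linorder_less_linear)
qed

text \<open>
  The exchange is found for some \<open>c \<in> A\<close> first; a minimal exponent below \<open>c\<close> then serves as well, because
  passing to divisors does not raise the key.
\<close>

lemma minimal_exps_exchange:
  fixes A :: "('n::{finite,linorder} \<Rightarrow>\<^sub>0 nat) set"
  assumes A: "move_closed A" and a: "a \<in> minimal_exps A" and b: "b \<in> minimal_exps A"
    and less: "gen_key b < gen_key a"
  shows "\<exists>c\<in>minimal_exps A. \<exists>k. gen_key c < gen_key a \<and> expo a k < expo b k \<and> c \<unlhd> a + unit_exp k"
proof -
  have "\<exists>c\<in>A. \<exists>k. gen_key c < gen_key a \<and> expo a k < expo b k \<and> c \<unlhd> a + unit_exp k"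
  proof (cases "\<exists>k m. expo a k < expo b k \<and> expo a m = height a \<and>
      (expo a k + 2 \<le> expo a m \<or> expo a k + 1 = expo a m \<and> m < k)")
    case True
    then obtain k m where km: "expo a k < expo b k" "expo a m = height a"
      "expo a k + 2 \<le> expo a m \<or> expo a k + 1 = expo a m \<and> m < k" by blast
    then have "move k m a \<in> A"
      using A a expo_le_height[of a] by (auto simp: move_closed_def minimal_exps_def)
    moreover have "gen_key (move k m a) < gen_key a"
      using km(2,3) gen_key_move_flatter gen_key_move_swap by blast
    ultimately show ?thesis using km(1) move_dvd[of k m a] by blast
  next
    case False
    then have "total_degree b \<noteq> total_degree a"
      using same_degree_exchange less by blast
    then have deg: "total_degree b < total_degree a"
      using less by (auto simp: gen_key_def)
    obtain m where m: "expo a m = height a" using height_attained by blast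
    have "\<exists>c\<in>A. \<exists>k. total_degree c < total_degree a \<and> expo a k < expo b k \<and> c \<unlhd> a + unit_exp k"
    proof (rule excess_reduction[OF A _ _ deg])
      show "\<not> c \<unlhd> a" if "c \<in> A" "total_degree c < total_degree a" for c
        using that a by (auto simp: minimal_exps_def)
      show "b \<in> A" using b by (simp add: minimal_exps_def)
      show "expo a i \<le> expo a k + 1" if "expo a k < expo b k" for k i
      proof -
        have "\<not> expo a k + 2 \<le> expo a m" using False m that by blast
        then show ?thesis using expo_le_height[of a i] m by linarith
      qed
    qed
    then show ?thesis using gen_key_less_if_degree_less by blast
  qed
  then obtain c k where c: "c \<in> A" "gen_key c < gen_key a" "expo a k < expo b k"
    "c \<unlhd> a + unit_exp k" by blast
  obtain d where d: "d \<in> minimal_exps A" "d \<unlhd> c"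
    using ex_minimal_exp_below[OF c(1)] by blast
  then have "gen_key d < gen_key a"
    using c(2) exp_dvd_imp_gen_key_le order.strict_trans1 by blast
  then show ?thesis using c d exp_dvd_trans by blast
qed

section \<open>Monomial ideals\<close>

lemma keys_monom [simp]: "Poly_Mapping.keys (monom a :: ('n, 'k::field) mpoly) = {a}"
  by (simp add: monom_def)

lemma inj_monom: "inj (monom :: _ \<Rightarrow> ('n, 'k::field) mpoly)"
  by (rule injI) (metis keys_monom the_elem_eq)

lemma monom_0 [simp]: "monom 0 = 1"
  by (simp add: monom_def)

lemma monom_mult: "monom a * monom b = monom (a + b)"
  by (simp add: monom_def mult_single)

lemma poly_expansion:
  "f = (\<Sum>m\<in>Poly_Mapping.keys f. Poly_Mapping.single m (Poly_Mapping.lookup f m))"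
  by (rule poly_mapping_eqI) (simp add: lookup_sum lookup_single when_def in_keys_iff)

lemma keys_mult_monom:
  fixes f :: "('n, 'k::field) mpoly"
  shows "Poly_Mapping.keys (f * monom a) = (\<lambda>m. m + a) ` Poly_Mapping.keys f"
proof
  show "Poly_Mapping.keys (f * monom a) \<subseteq> (\<lambda>m. m + a) ` Poly_Mapping.keys f"
    using keys_mult[of f "monom a"] by auto
  have "f * monom a =
      (\<Sum>m\<in>Poly_Mapping.keys f. Poly_Mapping.single (m + a) (Poly_Mapping.lookup f m))"
    by (subst (1) poly_expansion[of f]) (simp add: sum_distrib_right monom_def mult_single)
  then have "Poly_Mapping.lookup (f * monom a) (m + a) = Poly_Mapping.lookup f m" for m
    by (simp add: lookup_sum lookup_single when_def in_keys_iff)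
  then show "(\<lambda>m. m + a) ` Poly_Mapping.keys f \<subseteq> Poly_Mapping.keys (f * monom a)"
    by (auto simp: in_keys_iff)
qed

text \<open>
  The polynomials all of whose monomials are divisible by a generator form an ideal.
\<close>

lemma mem_monomial_ideal_iff:
  fixes f :: "('n, 'k::field) mpoly"
  shows "f \<in> ideal_gen (monom ` M) \<longleftrightarrow> (\<forall>m\<in>Poly_Mapping.keys f. \<exists>g\<in>M. g \<unlhd> m)"
proof
  let ?S = "{f :: ('n, 'k) mpoly. \<forall>m\<in>Poly_Mapping.keys f. \<exists>g\<in>M. g \<unlhd> m}"
  have "is_ideal ?S"
  proof (rule module.subspaceI[OF module_times])
    show "x + y \<in> ?S" if "x \<in> ?S" "y \<in> ?S" for x y
      using that keys_add[of x y] by blast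
    show "c * x \<in> ?S" if x: "x \<in> ?S" for c x
    proof safe
      fix m assume "m \<in> Poly_Mapping.keys (c * x)"
      then obtain a b where m: "m = a + b" "b \<in> Poly_Mapping.keys x"
        using keys_mult[of c x] by blast
      then obtain g where g: "g \<in> M" "g \<unlhd> b" using x by blast
      have "b \<unlhd> m" using exp_dvd_add[of b a] m(1) by (simp add: add.commute)
      then show "\<exists>g\<in>M. g \<unlhd> m" using g exp_dvd_trans by blast
    qed
  qed simp
  moreover have "monom ` M \<subseteq> ?S" by (auto intro: exp_dvd_refl)
  ultimately have "ideal_gen (monom ` M) \<subseteq> ?S"
    by (intro module.span_minimal[OF module_times])
  then show "\<forall>m\<in>Poly_Mapping.keys f. \<exists>g\<in>M. g \<unlhd> m" if "f \<in> ideal_gen (monom ` M)"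
    using that by blast
next
  assume f: "\<forall>m\<in>Poly_Mapping.keys f. \<exists>g\<in>M. g \<unlhd> m"
  have "Poly_Mapping.single m c \<in> ideal_gen (monom ` M)" if m: "m \<in> Poly_Mapping.keys f" for m c
  proof -
    obtain g where g: "g \<in> M" "g \<unlhd> m" using f m by blast
    have "m - g + g = m"
      using exp_dvd_diff_add[OF g(2)] by (simp add: add.commute)
    then have eq: "Poly_Mapping.single m c = Poly_Mapping.single (m - g) c * monom g"
      by (simp add: monom_def mult_single)
    show ?thesis
      unfolding eq using g(1)
      by (intro module.span_scale[OF module_times] module.span_base[OF module_times]) blast
  qed
  then have "(\<Sum>m\<in>Poly_Mapping.keys f. Poly_Mapping.single m (Poly_Mapping.lookup f m))
      \<in> ideal_gen (monom ` M)"
    by (rule module.span_sum[OF module_times])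
  then show "f \<in> ideal_gen (monom ` M)"
    by (simp only: poly_expansion[symmetric])
qed

lemma monom_mem_monomial_ideal_iff: "monom a \<in> ideal_gen (monom ` M) \<longleftrightarrow> (\<exists>g\<in>M. g \<unlhd> a)"
  by (simp add: mem_monomial_ideal_iff)

definition exps :: "('n, 'k::field) mpoly set \<Rightarrow> ('n \<Rightarrow>\<^sub>0 nat) set" where
  "exps I = {a. monom a \<in> I}"

lemma monomial_ideal_gens_iff:
  assumes "is_monomial_ideal I"
  shows "ideal_gen (monom ` M) = I \<longleftrightarrow> M \<subseteq> exps I \<and> (\<forall>a\<in>exps I. \<exists>g\<in>M. g \<unlhd> a)"
proof
  assume I: "ideal_gen (monom ` M) = I"
  show "M \<subseteq> exps I \<and> (\<forall>a\<in>exps I. \<exists>g\<in>M. g \<unlhd> a)"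
    unfolding exps_def I[symmetric] monom_mem_monomial_ideal_iff by (auto intro: exp_dvd_refl)
next
  assume M: "M \<subseteq> exps I \<and> (\<forall>a\<in>exps I. \<exists>g\<in>M. g \<unlhd> a)"
  obtain N where N: "I = ideal_gen (monom ` N)"
    using assms by (auto simp: is_monomial_ideal_def)
  have "N \<subseteq> exps I"
    unfolding exps_def N monom_mem_monomial_ideal_iff by (auto intro: exp_dvd_refl)
  then have "\<forall>g\<in>N. \<exists>h\<in>M. h \<unlhd> g" using M by blast
  moreover have "\<forall>h\<in>M. \<exists>g\<in>N. g \<unlhd> h"
    using M unfolding exps_def N monom_mem_monomial_ideal_iff by blast
  ultimately show "ideal_gen (monom ` M) = I"
    unfolding N set_eq_iff mem_monomial_ideal_iff by (meson exp_dvd_trans)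
qed

text \<open>
  Any set of exponents generating \<open>I\<close> contains the minimal ones, as each of these is divisible by a
  generator; and the minimal ones suffice. So they form the only irredundant system.
\<close>

lemma min_gens_eq:
  fixes I :: "('n::finite, 'k::field) mpoly set"
  assumes I: "is_monomial_ideal I"
  shows "min_gens I = monom ` minimal_exps (exps I)"
proof -
  let ?M = "minimal_exps (exps I)"
  have contained: "?M \<subseteq> M" if "ideal_gen (monom ` M) = I" for M
    using that unfolding monomial_ideal_gens_iff[OF I] minimal_exps_def by blast
  have gens: "ideal_gen (monom ` ?M) = I"
    unfolding monomial_ideal_gens_iff[OF I] using ex_minimal_exp_below
    by (auto simp: minimal_exps_def)
  have "is_min_monomial_gens (monom ` ?M) I"
    unfolding is_min_monomial_gens_def
  proof (intro conjI allI impI)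
    fix H :: "('n, 'k) mpoly set" assume H: "H \<subset> monom ` ?M"
    then obtain N where "H = monom ` N" "N \<subseteq> ?M" by (meson psubsetE subset_imageE)
    then show "ideal_gen H \<noteq> I" using contained H by blast
  qed (use gens in auto)
  moreover have "G = monom ` ?M" if G: "is_min_monomial_gens G I" for G
  proof -
    obtain M where M: "G = monom ` M"
      using G unfolding is_min_monomial_gens_def by (meson subset_imageE)
    then have "monom ` ?M \<subseteq> G"
      using contained G by (auto simp: is_min_monomial_gens_def)
    then show ?thesis
      using G gens unfolding is_min_monomial_gens_def by blast
  qed
  ultimately show ?thesis
    unfolding min_gens_def by (rule the_equality)
qed

text \<open>
  The variables in the colon ideal are always those in \<open>V\<close>. The assumption on \<open>T\<close> makes them generate it:
  if \<open>x\<^sup>t\<close> divides \<open>x\<^sup>m x\<^sup>a\<close>, then \<open>x\<^sup>m\<close> must contain each variable \<open>x\<^sub>i\<close> in which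
  \<open>t\<close> exceeds \<open>a\<close>, and one of them belongs to \<open>V\<close>.
\<close>

lemma colon_monomial_ideal:
  fixes a :: "'n \<Rightarrow>\<^sub>0 nat" and T :: "('n \<Rightarrow>\<^sub>0 nat) set"
  defines "V \<equiv> {i. \<exists>t\<in>T. t \<unlhd> a + unit_exp i}"
  assumes T: "\<And>t. t \<in> T \<Longrightarrow> \<exists>i\<in>V. expo a i < expo t i"
  shows "colon (ideal_gen (monom ` T)) (monom a :: ('n, 'k::field) mpoly) = ideal_gen (Var ` V)"
proof -
  have unit_dvd: "unit_exp i \<unlhd> m \<longleftrightarrow> 0 < expo m i" for i :: 'n and m
    by (auto simp: exp_dvd_def lookup_single when_def)
  have "(\<exists>t\<in>T. t \<unlhd> m + a) \<longleftrightarrow> (\<exists>i\<in>V. 0 < expo m i)" for m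
  proof
    assume "\<exists>t\<in>T. t \<unlhd> m + a"
    then obtain t where t: "t \<in> T" "t \<unlhd> m + a" by blast
    then obtain i where i: "i \<in> V" "expo a i < expo t i" using T by blast
    have "expo t i \<le> expo m i + expo a i"
      using t(2) by (simp add: exp_dvd_def lookup_add)
    then show "\<exists>i\<in>V. 0 < expo m i" using i by (intro bexI[of _ i]) auto
  next
    assume "\<exists>i\<in>V. 0 < expo m i"
    then obtain i t where i: "0 < expo m i" and t: "t \<in> T" "t \<unlhd> a + unit_exp i"
      unfolding V_def by blast
    have "a + unit_exp i \<unlhd> m + a"
      using i by (auto simp: exp_dvd_def lookup_add lookup_single when_def)
    then show "\<exists>t\<in>T. t \<unlhd> m + a" using t exp_dvd_trans by blast
  qed
  then have "f * monom a \<in> ideal_gen (monom ` T) \<longleftrightarrow> f \<in> ideal_gen (monom ` unit_exp ` V)"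
    for f :: "('n, 'k) mpoly"
    unfolding mem_monomial_ideal_iff keys_mult_monom bex_simps ball_simps unit_dvd by simp
  moreover have "Var ` V = (monom ` unit_exp ` V :: ('n, 'k) mpoly set)"
    by (simp add: Var_def image_image)
  ultimately show ?thesis
    unfolding colon_def by auto
qed

section \<open>The action of permutations\<close>

definition permute_exp :: "('n \<Rightarrow> 'n) \<Rightarrow> ('n::finite \<Rightarrow>\<^sub>0 nat) \<Rightarrow> ('n \<Rightarrow>\<^sub>0 nat)" where
  "permute_exp \<sigma> a = (\<Sum>i\<in>UNIV. Poly_Mapping.single (\<sigma> i) (expo a i))"

lemma expo_permute_exp:
  assumes "bij \<sigma>"
  shows "expo (permute_exp \<sigma> a) (\<sigma> i) = expo a i"
  using bij_is_inj[OF assms]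
  by (simp add: permute_exp_def lookup_sum lookup_single when_def inj_eq)

lemma Var_power: "Var i ^ e = monom (Poly_Mapping.single i e)"
  by (induction e) (simp_all add: Var_def monom_mult single_add[symmetric])

lemma prod_monom: "finite F \<Longrightarrow> (\<Prod>i\<in>F. monom (g i)) = monom (\<Sum>i\<in>F. g i)"
  by (induction F rule: finite_induct) (simp_all add: monom_mult)

lemma act_monom: "act \<sigma> (monom a :: ('n::finite, 'k::field) mpoly) = monom (permute_exp \<sigma> a)"
proof -
  have "Const (Poly_Mapping.lookup (monom a :: ('n, 'k) mpoly) a) = (1 :: ('n, 'k) mpoly)"
    by (simp add: Const_def monom_def)
  then show ?thesis
    by (simp add: act_def Var_power prod_monom permute_exp_def)
qed

lemma permute_exp_in_exps:
  assumes "sym_fixed I" "bij \<sigma>" "a \<in> exps I"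
  shows "permute_exp \<sigma> a \<in> exps I"
  using assms unfolding sym_fixed_def exps_def mem_Collect_eq act_monom[symmetric] by blast

lemma ex_sorting_bij:
  fixes g :: "'n::{finite,linorder} \<Rightarrow> nat"
  shows "\<exists>\<pi>::'n \<Rightarrow> 'n. bij \<pi> \<and> mono (g \<circ> \<pi>)"
proof -
  \<comment> \<open>send the \<open>p\<close>-th index to the \<open>p\<close>-th one in the order of increasing \<open>g\<close>\<close>
  define xs where "xs = sorted_list_of_set (UNIV :: 'n set)"
  define ys where "ys = sort_key g xs"
  let ?N = "{..<length xs}"
  have xs: "bij_betw ((!) xs) ?N UNIV"
    by (rule bij_betw_nth) (simp_all add: xs_def)
  have ys: "bij_betw ((!) ys) ?N UNIV"
    by (rule bij_betw_nth) (simp_all add: xs_def ys_def)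
  define ix where "ix = the_inv_into ?N ((!) xs)"
  have ix: "bij_betw ix UNIV ?N"
    unfolding ix_def by (rule bij_betw_the_inv_into[OF xs])
  have xs_ix: "xs ! ix i = i" for i
    unfolding ix_def using xs by (simp add: bij_betw_def f_the_inv_into_f)
  have ix_less: "ix i < length xs" for i
    using ix by (auto simp: bij_betw_def)
  have "ix i \<le> ix j" if "i \<le> j" for i j
  proof (rule ccontr)
    assume "\<not> ix i \<le> ix j"
    then have "xs ! ix j < xs ! ix i"
      using strict_sorted_list_of_set[of "UNIV :: 'n set"] ix_less
      by (simp add: xs_def sorted_wrt_nth_less)
    then show False using that xs_ix by simp
  qed
  moreover have "g (ys ! p) \<le> g (ys ! q)" if "p \<le> q" "q < length xs" for p q
    using that sorted_nth_mono[of "map g ys" p q] by (simp add: ys_def)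
  ultimately have "mono (g \<circ> ((!) ys \<circ> ix))"
    using ix_less by (auto simp: mono_def)
  moreover have "bij ((!) ys \<circ> ix)"
    by (rule bij_betw_trans[OF ix ys])
  ultimately show ?thesis by blast
qed

text \<open>
  For a shift at an arbitrary index of a largest entry, the sorting permutation must send the last position
  to this particular index.
\<close>

lemma ex_sorting_bij_last:
  fixes f :: "'n::{finite,linorder} \<Rightarrow> nat"
  assumes max: "\<And>i. f i \<le> f m"
  shows "\<exists>\<pi>::'n \<Rightarrow> 'n. bij \<pi> \<and> mono (f \<circ> \<pi>) \<and> \<pi> last_index = m"
proof -
  \<comment> \<open>doubling \<open>f\<close> leaves room to break the tie between the maxima of \<open>f\<close> in favour of \<open>m\<close>\<close>
  define g where "g i = 2 * f i + (if i = m then 1 else 0)" for i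
  obtain \<pi> :: "'n \<Rightarrow> 'n" where \<pi>: "bij \<pi>" "mono (g \<circ> \<pi>)" using ex_sorting_bij by blast
  have "f (\<pi> i) \<le> f (\<pi> j)" if "i \<le> j" for i j
  proof -
    have "g (\<pi> i) \<le> g (\<pi> j)" using \<pi>(2) that by (simp add: mono_def)
    then show ?thesis by (auto simp: g_def split: if_splits)
  qed
  moreover have "\<pi> last_index = m"
  proof -
    obtain j where "\<pi> j = m" using \<pi>(1) by (metis bij_pointE)
    then have "g m \<le> g (\<pi> last_index)"
      using \<pi>(2) by (metis Max_ge UNIV_I comp_apply finite monoD)
    then show ?thesis
      using max[of "\<pi> last_index"] by (auto simp: g_def split: if_splits)
  qed
  ultimately show ?thesis using \<pi>(1) by (auto simp: mono_def)
qed

text \<open>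
  Sort \<open>a\<close> so that \<open>m\<close> becomes the last index, apply the shifting condition, and permute back.
\<close>

lemma move_closed_exps:
  fixes I :: "('n::{finite,linorder}, 'k::field) mpoly set"
  assumes I: "symmetric_shifted_ideal I"
  shows "move_closed (exps I)"
  unfolding move_closed_def
proof (intro ballI allI impI)
  fix a k m
  assume a: "a \<in> exps I" and less: "expo a k < expo a m" and max: "\<forall>i. expo a i \<le> expo a m"
  have sym: "sym_fixed I" using I by (simp add: symmetric_shifted_ideal_def)
  obtain \<pi> :: "'n \<Rightarrow> 'n" where \<pi>: "bij \<pi>" "mono (expo a \<circ> \<pi>)" "\<pi> last_index = m"
    using ex_sorting_bij_last[of "expo a" m] max by blast
  have inv: "bij (inv \<pi>)" and inv_\<pi>: "\<And>i. inv \<pi> (\<pi> i) = i"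
    using \<pi>(1) by (simp_all add: bij_imp_bij_inv bij_is_inj)
  obtain l where l: "\<pi> l = k" using \<pi>(1) by (metis bij_pointE)
  define \<mu> where "\<mu> = permute_exp (inv \<pi>) a"
  have \<mu>: "expo \<mu> i = expo a (\<pi> i)" for i
    using expo_permute_exp[OF inv, of a "\<pi> i"] by (simp add: \<mu>_def inv_\<pi>)
  have "\<mu> \<in> exps I"
    unfolding \<mu>_def by (rule permute_exp_in_exps[OF sym inv a])
  then have "\<mu> \<in> partitions_of I"
    using \<pi>(2) by (simp add: partitions_of_def partitions_def exps_def \<mu> comp_def mono_def)
  moreover have less': "expo \<mu> l < expo \<mu> last_index"
    using less by (simp add: \<mu> l \<pi>(3))
  moreover have "l < last_index"
    using less' by (metis Max_ge UNIV_I finite order_less_irrefl order_le_less)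
  ultimately have "move l last_index \<mu> \<in> exps I"
    using I by (simp add: symmetric_shifted_ideal_def exps_def move_def)
  then have "permute_exp \<pi> (move l last_index \<mu>) \<in> exps I"
    by (rule permute_exp_in_exps[OF sym \<pi>(1)])
  moreover have "permute_exp \<pi> (move l last_index \<mu>) = move k m a"
  proof (rule poly_mapping_eqI)
    fix j
    obtain i where i: "j = \<pi> i" using \<pi>(1) by (metis bij_pointE)
    have "expo (move l last_index \<mu>) i = expo (move k m a) (\<pi> i)"
    proof -
      have "i = l \<longleftrightarrow> \<pi> i = k" "i = last_index \<longleftrightarrow> \<pi> i = m"
        using l \<pi>(3) inv_\<pi> by metis+
      moreover have "0 < expo \<mu> last_index" "l \<noteq> last_index" "0 < expo a m" "k \<noteq> m"
        using less less' by auto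
      ultimately show ?thesis
        by (simp add: expo_move \<mu> l \<pi>(3))
    qed
    then show "expo (permute_exp \<pi> (move l last_index \<mu>)) j = expo (move k m a) j"
      using expo_permute_exp[OF \<pi>(1)] i by simp
  qed
  ultimately show "move k m a \<in> exps I" by simp
qed

section \<open>Linear quotients\<close>

theorem theorem3p2:
  fixes I :: "('n::{finite,linorder}, 'k::field) mpoly set"
  assumes "symmetric_shifted_ideal I"
  shows "linear_quotients I"
proof -
  let ?G = "minimal_exps (exps I)"
  have closed: "move_closed (exps I)"
    using assms by (rule move_closed_exps)
  obtain xs where xs: "set xs = ?G" "distinct xs"
    using finite_distinct_list[OF finite_minimal_exps] by blast
  define L where "L = sort_key gen_key xs"
  have L: "set L = ?G" "distinct L" "sorted (map gen_key L)"
    using xs by (simp_all add: L_def)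
  let ?us = "map monom L :: ('n, 'k) mpoly list"
  have "\<exists>V. colon (ideal_gen (set (take k ?us))) (?us ! k) = ideal_gen (Var ` V)"
    if k: "k < length ?us" for k
  proof -
    let ?a = "L ! k" and ?T = "set (take k L)"
    have earlier: "t \<in> ?T \<longleftrightarrow> gen_key t < gen_key ?a" if "t \<in> ?G" for t
    proof -
      obtain j where j: "j < length L" "t = L ! j"
        using \<open>t \<in> ?G\<close> L(1) by (metis in_set_conv_nth)
      have "t \<in> ?T \<longleftrightarrow> j < k"
        using j k L(2) by (auto simp: in_set_conv_nth nth_eq_iff_index_eq)
      moreover have "j < k \<longleftrightarrow> gen_key t < gen_key ?a"
      proof
        assume "j < k"
        then have "gen_key t \<le> gen_key ?a" "t \<noteq> ?a"
          using sorted_nth_mono[OF L(3), of j k] j k L(2) by (auto simp: nth_eq_iff_index_eq)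
        then show "gen_key t < gen_key ?a" by (simp add: order_less_le)
      next
        assume less: "gen_key t < gen_key ?a"
        show "j < k"
        proof (rule ccontr)
          assume "\<not> j < k"
          then have "gen_key ?a \<le> gen_key t"
            using sorted_nth_mono[OF L(3), of k j] j k by simp
          then show False using less by simp
        qed
      qed
      ultimately show ?thesis by simp
    qed
    have "\<exists>i\<in>{i. \<exists>t\<in>?T. t \<unlhd> ?a + unit_exp i}. expo ?a i < expo t i" if t: "t \<in> ?T" for t
    proof -
      have "t \<in> ?G" using t L(1) set_take_subset[of k L] by blast
      have "?a \<in> ?G" using k L(1) nth_mem[of k L] by simp
      obtain c i where c: "c \<in> ?G" "gen_key c < gen_key ?a"
          "expo ?a i < expo t i" "c \<unlhd> ?a + unit_exp i"
        using minimal_exps_exchange[OF closed \<open>?a \<in> ?G\<close> \<open>t \<in> ?G\<close>] earlier[OF \<open>t \<in> ?G\<close>] t by blast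
      then have "c \<in> ?T" using earlier by simp
      then show ?thesis using c by auto
    qed
    from colon_monomial_ideal[OF this] show ?thesis
      using k by (auto simp: take_map)
  qed
  moreover have "distinct ?us" "set ?us = min_gens I"
    using L inj_on_subset[OF inj_monom] min_gens_eq[of I] assms
    by (auto simp: distinct_map symmetric_shifted_ideal_def)
  ultimately show ?thesis
    unfolding linear_quotients_def by blast
qed

end
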